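(* Let $\mathcal{PB}_2^h(x,E)$ be the Piterbarg-Berman function with $E=[a,b]$, $a<b$, $a,b\in\mathbb R$, and $x\in[0,b-a]$. (i) If $h(t)+t^2$ is a continuous, concave function on $E$, then $$ \begin{aligned} \mathcal{PB}_2^h(x,E)=&\int_{\mathbb R}e^z\,\mathbb P\{f_{\mathcal N}(s^* )\le0\}\,dz\\ &+\int_{\mathbb R}e^z\Big[\mathbb P\{f_{\mathcal N}(a+x)<0,\ f_{\mathcal N}(b)\ge0\}+\mathbb P\{f_{\mathcal N}(a)\ge0,\ f_{\mathcal N}(b-x)<0\}\Big]dz\\ &+\int_{\mathbb R}e^z\,\mathbb P\{b-a-(s_2-s_1)>x,\ f_{\mathcal N}(s^* )>0,\ f_{\mathcal N}(a)<0,\ f_{\mathcal N}(b)<0\}\,dz . \end{aligned} $$ (ii) If $h(t)+t^2$, $t\in\mathbb R$, is continuous and concave, and the right derivative $h'_+(a)$ and the left derivative $h'_-(b)$ exist with finite values, then $h'_+(b)\le h'_-(a)$ and $$ \begin{aligned} \mathcal{PB}_2^h(x,E)=&\int_{-\infty}^{-h(0)}e^z\,\mathbb P\{f_{\mathcal N}(t^* )\le0\}\,dz\\ &+\int_{\mathbb R}e^z\Big[\mathbb P\{f_{\mathcal N}(a+x)<0,\ \sqrt2\mathcal N\le h'_-(b)+2b\}+\mathbb P\{f_{\mathcal N}(b-x)<0,\ \sqrt2\mathcal N\ge h'_+(a)+2a\}\Big]dz\\ &+\int_{\mathbb R}e^z\,\mathbb P\{\max(t_1-a,0)+\max(b-t_2,0)>x,\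 h'_-(b)+2b<\sqrt2\mathcal N<h'_+(a)+2a,\ f_{\mathcal N}(t^* )>0\}\,dz . \end{aligned} $$
   Context: Let $\mathcal N\sim N(0,1)$. For an interval $E$ and a drift function $h$ continuous on $E$, the Piterbarg-Berman function (for the fractional Brownian motion $B_2(t)=\mathcal N t$) is $$\mathcal{PB}_2^h(x,E)=\int_{\mathbb R}e^z\,\mathbb P\Big\{\int_E\mathbb I\big(\sqrt2\,\mathcal N t-t^2-h(t)-z>0\big)\,dt>x\Big\}\,dz,\qquad x\in[0,\mathrm{mes}(E)].$$ For $z\in\mathbb R$ put $f_{\mathcal N}(t)=f_{\mathcal N}(t,z)=h(t)+t^2-\sqrt2\,\mathcal N t+z$. The symbols $h'_+$ and $h'_-$ denote right and left derivatives of $h$. In (i), $f_{\mathcal N}(s^* )=\max_{s\in E}f_{\mathcal N}(s)$ and, if $f_{\mathcal N}(s^* )>0$, $s_1<s_2$ are the two random solutions of $f_{\mathcal N}(s)=0$, $s\in E$. In (ii), $f_{\mathcal N}(t^* )=\max_{t\in\mathbb R}f_{\mathcal N}(t)$ and, if $f_{\mathcal N}(t^* )>0$, $t_1<t_2$ are the two random solutions of $f_{\mathcal N}(t)=0$, $t\in\mathbb R$.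
   Formalization: The formal version takes x in [0,b-a), as both formulas fail at x=b-a (left side 0, right side positive), and in (ii) intersects the first term's event with h'_-(b)+2b<√2N<h'_+(a)+2a, since the printed term double counts (e.g. h=-2t², E=[0,1], x=0). *)

theory Defs
  imports "HOL-Probability.Probability"
begin

text \<open>
  \<open>N\<close> is a random variable on the probability space \<open>M\<close>, meant to be standard normal.
  Integrals of non-negative functions are taken in \<open>ennreal\<close>, so that they are meaningful without an
  integrability side condition. The drift \<open>h\<close> is a total function; only its values on \<open>E\<close> matter.
\<close>

definition PB :: "'w measure \<Rightarrow> ('w \<Rightarrow> real) \<Rightarrow> (real \<Rightarrow> real) \<Rightarrow> real set \<Rightarrow> real \<Rightarrow> ennreal" where
  "PB M N h E x =
     (\<integral>\<^sup>+z. ennreal (exp z *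
        \<P>(\<omega> in M. (\<integral>\<^sup>+t\<in>E. indicator {t. sqrt 2 * N \<omega> * t - t\<^sup>2 - h t - z > 0} t \<partial>lborel) > ennreal x))
      \<partial>lborel)"

definition fN :: "(real \<Rightarrow> real) \<Rightarrow> real \<Rightarrow> real \<Rightarrow> real \<Rightarrow> real" where
  "fN h n z t = h t + t\<^sup>2 - sqrt 2 * n * t + z"

text \<open>
  The value \<open>f(s\<^sup>*)\<close> at a maximiser \<open>s\<^sup>*\<close> of \<open>f\<close> on \<open>E\<close>. It does not depend on the choice of the
  maximiser, and is only meaningful if a maximiser exists.
\<close>

definition max_val :: "(real \<Rightarrow> real) \<Rightarrow> real set \<Rightarrow> real" where
  "max_val f E = f (arg_max_on f E)"

text \<open>
  The two solutions \<open>s\<^sub>1 < s\<^sub>2\<close> in \<open>E\<close> of \<open>f(s) = 0\<close>; only meaningful if there are exactly two solutions.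
\<close>

definition two_zeros :: "(real \<Rightarrow> real) \<Rightarrow> real set \<Rightarrow> real \<times> real" where
  "two_zeros f E = (THE p. fst p < snd p \<and> {s \<in> E. f s = 0} = {fst p, snd p})"

definition zero1 :: "(real \<Rightarrow> real) \<Rightarrow> real set \<Rightarrow> real" where
  "zero1 f E = fst (two_zeros f E)"

definition zero2 :: "(real \<Rightarrow> real) \<Rightarrow> real set \<Rightarrow> real" where
  "zero2 f E = snd (two_zeros f E)"

end

theory Submission
  imports Defs
begin

text \<open>
  The integrand of the left-hand side is the event that the time \<open>f\<^sub>N\<close> spends below zero in \<open>[a, b]\<close>
  exceeds \<open>x\<close>. Since \<open>f\<^sub>N\<close> is concave, the set where it is negative is all of \<open>[a, b]\<close>, an initial
  segment, a final segment, or the complement of the interval between the two zeros; an initial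
  segment is longer than \<open>x\<close> iff it contains \<open>a + x\<close>. In part (ii) the signs of the one-sided
  derivatives of \<open>f\<^sub>N\<close> at \<open>a\<close> and \<open>b\<close> decide between these cases. The events on the right-hand side
  partition the left-hand event except where the maximum of \<open>f\<^sub>N\<close> is exactly zero, which for fixed noise
  happens for at most one level \<open>z\<close>, and, in (ii), where the left derivative at \<open>b\<close> vanishes, which
  happens for one value of the noise. Both exceptions are null by Fubini.
\<close>

section \<open>Concave functions on the line\<close>

text \<open>Clearing the denominator \<open>z - x\<close> gives concavity a form from which signs
  and slopes can be read off directly.\<close>

lemma concave_on_chord:
  fixes f :: "real \<Rightarrow> real"
  assumes "concave_on I f" "x \<in> I" "z \<in> I" "x < y" "y < z"
  shows "f x * (z - y) + f z * (y - x) \<le> f y * (z - x)"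
proof -
  define t where "t = (y - x) / (z - x)"
  have t: "0 \<le> t" "t \<le> 1" "t * (z - x) = y - x"
    using assms(4,5) by (auto simp: t_def)
  have "(1 - t) * x + t * z = x + t * (z - x)" by (simp add: algebra_simps)
  then have y: "(1 - t) * x + t * z = y" by (simp only: t(3))
  have le: "(1 - t) * f x + t * f z \<le> f y"
    using concave_onD[OF assms(1) t(1,2) assms(2,3)] y by simp
  have d: "z - y = (1 - t) * (z - x)" "y - x = t * (z - x)"
    using t(3) by (simp_all add: algebra_simps)
  have "f x * (z - y) + f z * (y - x) = ((1 - t) * f x + t * f z) * (z - x)"
    unfolding d by (simp add: algebra_simps)
  also have "\<dots> \<le> f y * (z - x)"
    using le assms(4,5) by (intro mult_right_mono) auto
  finally show ?thesis .
qed

lemma concave_on_neg_between: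
  fixes f :: "real \<Rightarrow> real"
  assumes "concave_on I f" "x \<in> I" "z \<in> I" "x < y" "y < z" "f y < 0"
  shows "f x < 0 \<or> f z < 0"
proof (rule ccontr)
  assume "\<not> ?thesis"
  then have "0 \<le> f x * (z - y) + f z * (y - x)" using assms by auto
  also have "\<dots> \<le> f y * (z - x)" using concave_on_chord assms(1-5) by blast
  finally show False using assms(4-6) by (simp add: zero_le_mult_iff)
qed

text \<open>If one end value were positive and the other nonnegative, the left side of the chord
  inequality would be positive. The strict conclusion is what later separates roots from negative
  points.\<close>

lemma concave_on_nonpos_between:
  fixes f :: "real \<Rightarrow> real"
  assumes "concave_on I f" "x \<in> I" "z \<in> I" "x < y" "y < z" "f y \<le> 0"
  shows "0 < f x \<Longrightarrow> f z < 0" and "0 < f z \<Longrightarrow> f x < 0"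
proof -
  have *: "f x * (z - y) + f z * (y - x) \<le> f y * (z - x)"
    using concave_on_chord assms(1-5) by blast
  have **: "f y * (z - x) \<le> 0" using assms(4-6) by (simp add: mult_nonpos_nonneg)
  show "f z < 0" if "0 < f x"
  proof (rule ccontr)
    assume "\<not> f z < 0"
    then have "0 < f x * (z - y) + f z * (y - x)" using that assms by (intro add_pos_nonneg) auto
    then show False using * ** by linarith
  qed
  show "f x < 0" if "0 < f z"
  proof (rule ccontr)
    assume "\<not> f x < 0"
    then have "0 < f x * (z - y) + f z * (y - x)" using that assms by (intro add_nonneg_pos) auto
    then show False using * ** by linarith
  qed
qed

text \<open>The chord inequality is applied to the three points in their actual order. Allowing
  \<open>u\<close> and \<open>t\<close> on opposite sides of \<open>p\<close> lets a one-sided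
  derivative control the function on the other side as well.\<close>

lemma concave_on_slope_antimono:
  fixes f :: "real \<Rightarrow> real"
  assumes "concave_on I f" "p \<in> I" "u \<in> I" "t \<in> I" "u \<noteq> p" "t \<noteq> p" "u \<le> t"
  shows "(f t - f p) / (t - p) \<le> (f u - f p) / (u - p)"
proof -
  consider "u = t" | "u < t" "t < p" | "u < p" "p < t" | "p < u" "u < t"
    using assms(5-7) by linarith
  then show ?thesis
  proof cases
    case 2
    then show ?thesis
      using concave_on_chord[OF assms(1,3,2) 2] by (simp add: field_simps)
  next
    case 3
    then show ?thesis
      using concave_on_chord[OF assms(1,3,4) 3] by (simp add: field_simps)
  next
    case 4
    then show ?thesis
      using concave_on_chord[OF assms(1,2,4) 4] by (simp add: field_simps)
  qed auto
qed

text \<open>Slopes from \<open>p\<close> to nearby points are at least the slope to any point on the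
  right and at most the slope to any point on the left; this survives the limit. As \<open>T\<close>
  is arbitrary, left and right derivatives are treated at once.\<close>

lemma concave_on_le_tangent:
  fixes f :: "real \<Rightarrow> real"
  assumes f: "concave_on UNIV f"
    and D: "(f has_real_derivative D) (at p within T)"
    and nt: "at p within T \<noteq> bot"
  shows "f t \<le> f p + D * (t - p)"
proof -
  have lim: "((\<lambda>u. (f u - f p) / (u - p)) \<longlongrightarrow> D) (at p within T)"
    using D by (simp add: has_field_derivative_iff)
  have ne: "eventually (\<lambda>u. u \<noteq> p) (at p within T)"
    by (simp add: eventually_at_filter)
  consider "t = p" | "p < t" | "t < p" by linarith
  then show ?thesis
  proof cases
    case 2
    have "eventually (\<lambda>u. u < t) (at p within T)"
      using order_tendstoD(2)[OF tendsto_ident_at 2] .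
    with ne have "eventually (\<lambda>u. (f t - f p) / (t - p) \<le> (f u - f p) / (u - p)) (at p within T)"
      by eventually_elim (use 2 in \<open>auto intro!: concave_on_slope_antimono[OF f]\<close>)
    from tendsto_lowerbound[OF lim this nt] 2 show ?thesis by (simp add: field_simps)
  next
    case 3
    have "eventually (\<lambda>u. t < u) (at p within T)"
      using order_tendstoD(1)[OF tendsto_ident_at 3] .
    with ne have "eventually (\<lambda>u. (f u - f p) / (u - p) \<le> (f t - f p) / (t - p)) (at p within T)"
      by eventually_elim (use 3 in \<open>auto intro!: concave_on_slope_antimono[OF f]\<close>)
    from tendsto_upperbound[OF lim this nt] 3 show ?thesis by (simp add: field_simps)
  qed auto
qed

text \<open>To the right of \<open>p\<close> the slopes decrease in \<open>u\<close> and are bounded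
  by the slope to \<open>p - 1\<close>, so they converge as \<open>u\<close> tends to
  \<open>p\<close>; the minus sign makes them increasing, as \<open>Lim_right_bound\<close>
  requires.\<close>

lemma concave_on_has_right_derivative:
  fixes f :: "real \<Rightarrow> real"
  assumes "concave_on UNIV f"
  obtains D where "(f has_real_derivative D) (at_right p)"
proof -
  have "((\<lambda>u. - ((f u - f p) / (u - p))) \<longlongrightarrow>
      Inf ((\<lambda>u. - ((f u - f p) / (u - p))) ` ({p<..} \<inter> UNIV))) (at p within ({p<..} \<inter> UNIV))"
  proof (rule Lim_right_bound)
    show "- ((f (p - 1) - f p) / ((p - 1) - p)) \<le> - ((f u - f p) / (u - p))" if "p < u" for u
      using concave_on_slope_antimono[OF assms, of p "p - 1" u] that by auto
    show "- ((f u - f p) / (u - p)) \<le> - ((f v - f p) / (v - p))" if "p < u" "u \<le> v" for u v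
      using concave_on_slope_antimono[OF assms, of p u v] that by auto
  qed
  from tendsto_minus[OF this] show ?thesis
    by (intro that) (simp add: has_field_derivative_iff)
qed

lemma concave_on_has_left_derivative:
  fixes f :: "real \<Rightarrow> real"
  assumes "concave_on UNIV f"
  obtains D where "(f has_real_derivative D) (at_left p)"
proof -
  have "((\<lambda>u. - ((f u - f p) / (u - p))) \<longlongrightarrow>
      Sup ((\<lambda>u. - ((f u - f p) / (u - p))) ` ({..<p} \<inter> UNIV))) (at p within ({..<p} \<inter> UNIV))"
  proof (rule Lim_left_bound)
    show "- ((f u - f p) / (u - p)) \<le> - ((f (p + 1) - f p) / ((p + 1) - p))" if "u < p" for u
      using concave_on_slope_antimono[OF assms, of p u "p + 1"] that by auto
    show "- ((f u - f p) / (u - p)) \<le> - ((f v - f p) / (v - p))" if "v < p" "u \<le> v" for u v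
      using concave_on_slope_antimono[OF assms, of p u v] that by auto
  qed
  from tendsto_minus[OF this] show ?thesis
    by (intro that) (simp add: has_field_derivative_iff)
qed

lemma max_val_eq:
  assumes "m \<in> E" "\<And>t. t \<in> E \<Longrightarrow> f t \<le> f m"
  shows "max_val f E = f m"
  unfolding max_val_def arg_max_on_def using assms by (intro arg_max_equality)

text \<open>The intermediate value theorem gives a root on each side of \<open>m\<close>, and
  concavity fixes the sign everywhere else. Hence exactly one pair meets the description in
  \<open>two_zeros\<close>, and it does not depend on the negative witnesses \<open>p\<close> and
  \<open>q\<close>.\<close>

lemma concave_on_zeros:
  fixes f :: "real \<Rightarrow> real"
  assumes f: "concave_on I f" "continuous_on I f"
    and I: "p \<in> I" "m \<in> I" "q \<in> I" and le: "p < m" "m < q"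
    and sgn: "f p < 0" "0 < f m" "f q < 0"
  shows "zero1 f I < m" "m < zero2 f I"
    "\<And>t. t \<in> I \<Longrightarrow> f t < 0 \<longleftrightarrow> t < zero1 f I \<or> zero2 f I < t"
    "zero1 f I \<in> I" "zero2 f I \<in> I"
proof -
  have ivl: "{p..m} \<subseteq> I" "{m..q} \<subseteq> I"
    using atMostAtLeast_subset_convex concave_on_imp_convex[OF f(1)] I le by auto
  obtain s1 where s1: "p \<le> s1" "s1 \<le> m" "f s1 = 0"
    using IVT'[of f p 0 m] sgn le continuous_on_subset[OF f(2) ivl(1)] by auto
  obtain s2 where s2: "m \<le> s2" "s2 \<le> q" "f s2 = 0"
    using IVT2'[of f q 0 m] sgn le continuous_on_subset[OF f(2) ivl(2)] by auto
  have lt: "s1 < m" "m < s2" using s1 s2 sgn by (auto simp: less_le)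
  have s12: "s1 \<in> I" "s2 \<in> I" using s1 s2 ivl by auto
  have left: "f t < 0" if "t \<in> I" "t < s1" for t
    using concave_on_nonpos_between(2)[OF f(1) that(1) I(2) that(2) lt(1)] s1 sgn by simp
  have right: "f t < 0" if "t \<in> I" "s2 < t" for t
    using concave_on_nonpos_between(1)[OF f(1) I(2) that(1) lt(2) that(2)] s2 sgn by simp
  \<comment> \<open>A nonpositive value between a root and \<open>m\<close> would make
    \<open>f\<close> negative at the root, because \<open>f m\<close> is positive.\<close>
  have mid: "0 < f t" if t: "s1 < t" "t < s2" for t
  proof (rule ccontr)
    assume "\<not> 0 < f t"
    then have "f t \<le> 0" by simp
    consider "t = m" | "t < m" | "m < t" by linarith
    then show False
    proof cases
      case 2
      from concave_on_nonpos_between(2)[OF f(1) s12(1) I(2) t(1) 2 \<open>f t \<le> 0\<close>] s1 sgn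
      show False by simp
    next
      case 3
      from concave_on_nonpos_between(1)[OF f(1) I(2) s12(2) 3 t(2) \<open>f t \<le> 0\<close>] s2 sgn
      show False by simp
    qed (use sgn \<open>f t \<le> 0\<close> in auto)
  qed
  have iff: "f t < 0 \<longleftrightarrow> t < s1 \<or> s2 < t" if "t \<in> I" for t
    using left[OF that] right[OF that] mid[of t] s1 s2 lt
    by (cases t s1 rule: linorder_cases; cases t s2 rule: linorder_cases) auto
  have zs: "{s \<in> I. f s = 0} = {s1, s2}"
    using iff mid s1 s2 s12 by (auto simp: not_less) (metis less_irrefl not_less_iff_gr_or_eq)
  have "two_zeros f I = (s1, s2)"
    unfolding two_zeros_def zs using lt by (intro the_equality) (auto simp: doubleton_eq_iff)
  then have z: "zero1 f I = s1" "zero2 f I = s2" by (auto simp: zero1_def zero2_def)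
  show "zero1 f I < m" "m < zero2 f I" "zero1 f I \<in> I" "zero2 f I \<in> I"
    using lt s12 by (auto simp: z)
  show "f t < 0 \<longleftrightarrow> t < zero1 f I \<or> zero2 f I < t" if "t \<in> I" for t
    using iff[OF that] by (simp add: z)
qed

section \<open>The time spent below zero\<close>

text \<open>The inner integral of \<open>PB\<close> written as the measure of a set, so that it can
  be estimated by inclusions.\<close>

definition neg_time :: "(real \<Rightarrow> real) \<Rightarrow> real set \<Rightarrow> ennreal" where
  "neg_time f E = emeasure lborel {t \<in> E. f t < 0}"

lemma neg_time_eq_length: "a \<le> b \<Longrightarrow> (\<And>t. t \<in> {a..b} \<Longrightarrow> f t < 0) \<Longrightarrow> neg_time f {a..b} = b - a"
proof -
  assume "\<And>t. t \<in> {a..b} \<Longrightarrow> f t < 0" and "a \<le> b"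
  then have "{t \<in> {a..b}. f t < 0} = {a..b}" by force
  then show ?thesis using \<open>a \<le> b\<close> by (simp only: neg_time_def emeasure_lborel_Icc)
qed

lemma sets_neg_set:
  assumes "continuous_on {a..b} f"
  shows "{t \<in> {a..b}. f t < (0::real)} \<in> sets (borel :: real measure)"
proof -
  \<comment> \<open>Outside the interval the extension takes the value 0, which is not negative, so
    the set in question is unchanged.\<close>
  have "(\<lambda>t. indicator {a..b} t *\<^sub>R f t) \<in> borel_measurable borel"
    using assms by (intro borel_measurable_continuous_on_indicator) auto
  then have "{t \<in> space borel. indicator {a..b} t *\<^sub>R f t < 0} \<in> sets borel"
    by measurable
  also have "{t \<in> space borel. indicator {a..b} t *\<^sub>R f t < 0} = {t \<in> {a..b}. f t < 0}"
    by (auto simp: indicator_def)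
  finally show ?thesis .
qed

text \<open>By \<open>down\<close> the negative set is an initial segment of the interval. If it
  misses \<open>a + x\<close>, it fits into an interval of length \<open>x\<close>.\<close>

lemma neg_time_gt_initial:
  fixes f :: "real \<Rightarrow> real"
  assumes f: "continuous_on {a..b} f" and x: "0 \<le> x" "x < b - a"
    and down: "\<And>s t. a \<le> t \<Longrightarrow> t < s \<Longrightarrow> s \<le> b \<Longrightarrow> f s < 0 \<Longrightarrow> f t < 0"
  shows "ennreal x < neg_time f {a..b} \<longleftrightarrow> f (a + x) < 0"
proof
  assume less: "ennreal x < neg_time f {a..b}"
  show "f (a + x) < 0"
  proof (rule ccontr)
    assume *: "\<not> f (a + x) < 0"
    have "{t \<in> {a..b}. f t < 0} \<subseteq> {a..a + x}"
    proof safe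
      fix t assume "t \<in> {a..b}" "f t < 0"
      with * down[of "a + x" t] x show "t \<in> {a..a + x}"
        by (cases t "a + x" rule: linorder_cases) auto
    qed
    then have "neg_time f {a..b} \<le> emeasure lborel {a..a + x}"
      unfolding neg_time_def by (intro emeasure_mono) auto
    with less x show False by simp
  qed
next
  assume neg: "f (a + x) < 0"
  \<comment> \<open>Right continuity carries negativity to some \<open>s\<close> beyond
    \<open>a + x\<close>, which makes the time strictly larger than \<open>x\<close>;
    \<open>x < b - a\<close> leaves room for \<open>s\<close>.\<close>
  have "(f \<longlongrightarrow> f (a + x)) (at_right (a + x))"
    using x continuous_on_subset[OF f, of "{a + x..b}"] by (intro continuous_on_Icc_at_rightD) auto
  then have "eventually (\<lambda>t. f t < 0) (at_right (a + x))"
    using neg by (rule order_tendstoD)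
  moreover have "eventually (\<lambda>t. t \<in> {a + x<..<b}) (at_right (a + x))"
    using x by (intro eventually_at_right_real) auto
  ultimately have "eventually (\<lambda>t. f t < 0 \<and> t \<in> {a + x<..<b}) (at_right (a + x))"
    by eventually_elim auto
  then obtain s where s: "f s < 0" "a + x < s" "s < b"
    using eventually_happens'[OF trivial_limit_at_right_real] by force
  have "{a..s} \<subseteq> {t \<in> {a..b}. f t < 0}"
    using down[of _ s] s by (force simp: less_le)
  then have "emeasure lborel {a..s} \<le> neg_time f {a..b}"
    unfolding neg_time_def using sets_neg_set[OF f] by (intro emeasure_mono) auto
  moreover have "ennreal x < emeasure lborel {a..s}"
    using s x by (simp add: ennreal_less_iff)
  ultimately show "ennreal x < neg_time f {a..b}" by simp
qed

text \<open>The reflection of \<open>{a..b}\<close> preserves Lebesgue measure and turns final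
  segments into initial ones.\<close>

lemma neg_time_reflect:
  fixes f :: "real \<Rightarrow> real"
  assumes f: "continuous_on {a..b} f"
  shows "neg_time (\<lambda>t. f (a + b - t)) {a..b} = neg_time f {a..b}"
proof -
  have "neg_time f {a..b} = emeasure (distr lborel borel (\<lambda>t. a + b + (-1) * t)) {t \<in> {a..b}. f t < 0}"
    using lborel_real_affine[of "-1" "a + b"] unfolding neg_time_def
    by (simp add: density_1)
  also have "\<dots> = emeasure lborel ((\<lambda>t. a + b + (-1) * t) -` {t \<in> {a..b}. f t < 0} \<inter> space lborel)"
    using sets_neg_set[OF f] by (intro emeasure_distr) auto
  also have "(\<lambda>t. a + b + (-1) * t) -` {t \<in> {a..b}. f t < 0} \<inter> space lborel
      = {t \<in> {a..b}. f (a + b - t) < 0}"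
    by auto
  finally show ?thesis by (simp add: neg_time_def)
qed

lemma neg_time_gt_final:
  fixes f :: "real \<Rightarrow> real"
  assumes f: "continuous_on {a..b} f" and x: "0 \<le> x" "x < b - a"
    and up: "\<And>s t. a \<le> s \<Longrightarrow> s < t \<Longrightarrow> t \<le> b \<Longrightarrow> f s < 0 \<Longrightarrow> f t < 0"
  shows "ennreal x < neg_time f {a..b} \<longleftrightarrow> f (b - x) < 0"
proof -
  have "continuous_on {a..b} (\<lambda>t. f (a + b - t))"
    by (intro continuous_on_compose2[OF f] continuous_intros) auto
  then have "ennreal x < neg_time (\<lambda>t. f (a + b - t)) {a..b} \<longleftrightarrow> f (a + b - (a + x)) < 0"
  proof (rule neg_time_gt_initial[OF _ x])
    show "f (a + b - t) < 0" if "a \<le> t" "t < s" "s \<le> b" "f (a + b - s) < 0" for s t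
      using up[of "a + b - s" "a + b - t"] that by simp
  qed
  then show ?thesis by (simp add: neg_time_reflect[OF f])
qed

text \<open>The truncations at 0 handle roots of a function on the whole line that fall outside
  \<open>{a..b}\<close>: such a root contributes no gap on its side.\<close>

lemma neg_time_two_gaps:
  fixes f :: "real \<Rightarrow> real"
  assumes iff: "\<And>t. t \<in> {a..b} \<Longrightarrow> f t < 0 \<longleftrightarrow> t < s1 \<or> s2 < t"
    and s: "s1 \<le> s2" "s1 \<le> b" "a \<le> s2"
  shows "neg_time f {a..b} = ennreal (max (s1 - a) 0 + max (b - s2) 0)"
proof -
  have "{t \<in> {a..b}. f t < 0} = {a..<s1} \<union> {s2<..b}"
    using iff s by force
  then have "neg_time f {a..b} = emeasure lborel ({a..<s1} \<union> {s2<..b})"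
    by (simp only: neg_time_def)
  also have "\<dots> = emeasure lborel {a..<s1} + emeasure lborel {s2<..b}"
    using s by (intro plus_emeasure[symmetric]) auto
  also have "emeasure lborel {a..<s1} = ennreal (max (s1 - a) 0)"
    by (cases "a \<le> s1") auto
  also have "emeasure lborel {s2<..b} = ennreal (max (b - s2) 0)"
    by (cases "s2 \<le> b") auto
  finally show ?thesis by (simp add: ennreal_plus)
qed

section \<open>Maximum, roots and decomposition of the event for a single path\<close>

lemma max_val_Icc_le_0_iff:
  fixes f :: "real \<Rightarrow> real"
  assumes "continuous_on {a..b} f" "a \<le> b"
  shows "max_val f {a..b} \<le> 0 \<longleftrightarrow> (\<forall>t\<in>{a..b}. f t \<le> 0)"
proof -
  obtain m where m: "m \<in> {a..b}" "\<And>t. t \<in> {a..b} \<Longrightarrow> f t \<le> f m"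
    using continuous_attains_sup[of "{a..b}" f] assms by auto
  then have "max_val f {a..b} = f m" by (intro max_val_eq)
  with m show ?thesis using order_trans by metis
qed

lemma zeros_gap_iff:
  fixes f :: "real \<Rightarrow> real"
  assumes f: "concave_on {a..b} f" "continuous_on {a..b} f"
    and sgn: "f a < 0" "f b < 0" "\<exists>t\<in>{a..b}. 0 < f t" and x: "0 \<le> x"
  shows "b - a - (zero2 f {a..b} - zero1 f {a..b}) > x \<longleftrightarrow> ennreal x < neg_time f {a..b}"
proof -
  obtain m where m: "m \<in> {a..b}" "0 < f m" using sgn by auto
  then have am: "a < m" "m < b" using sgn by (auto simp: less_le)
  note z = concave_on_zeros[OF f _ m(1) _ am sgn(1) m(2) sgn(2)]
  have "neg_time f {a..b} = ennreal (max (zero1 f {a..b} - a) 0 + max (b - zero2 f {a..b}) 0)"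
    using z am by (intro neg_time_two_gaps) auto
  moreover have "a \<le> zero1 f {a..b}" "zero2 f {a..b} \<le> b" using z am by auto
  ultimately show ?thesis using x by (auto simp: ennreal_less_iff simp del: ennreal_plus)
qed

text \<open>An equation between sums of indicators says at once that the four events on the right
  are disjoint and exhaust \<open>L\<close>, and it can be integrated directly. The hypothesis
  \<open>max\<close> excludes a maximum equal to 0: then the first event could overlap a middle one,
  or hold with \<open>L\<close> false, as for \<open>f\<close> identically 0.\<close>

lemma occupation_split_Icc:
  fixes f :: "real \<Rightarrow> real"
  assumes f: "concave_on {a..b} f" "continuous_on {a..b} f"
    and x: "0 \<le> x" "x < b - a"
    and max: "\<not> ((\<forall>t\<in>{a..b}. f t \<le> 0) \<and> (\<exists>t\<in>{a..b}. f t = 0))"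
  defines "L \<equiv> ennreal x < neg_time f {a..b}"
  shows "(of_bool L :: ennreal) = of_bool (\<forall>t\<in>{a..b}. f t \<le> 0)
    + (of_bool (f (a + x) < 0 \<and> f b \<ge> 0) + of_bool (f a \<ge> 0 \<and> f (b - x) < 0))
    + of_bool (L \<and> (\<exists>t\<in>{a..b}. f t > 0) \<and> f a < 0 \<and> f b < 0)"
proof -
  have ab: "a \<in> {a..b}" "b \<in> {a..b}" using x by auto
  \<comment> \<open>By concavity a point with nonnegative value cannot be followed by a negative one
    when \<open>f b\<close> is nonnegative, so the negative set starts at \<open>a\<close>.\<close>
  have initial: "L \<longleftrightarrow> f (a + x) < 0" if b: "0 \<le> f b"
    unfolding L_def
  proof (rule neg_time_gt_initial[OF f(2) x])
    show "f t < 0" if "a \<le> t" "t < s" "s \<le> b" "f s < 0" for s t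
      using concave_on_neg_between[OF f(1), of t b s] b that by (cases "s = b") auto
  qed
  have final: "L \<longleftrightarrow> f (b - x) < 0" if a: "0 \<le> f a"
    unfolding L_def
  proof (rule neg_time_gt_final[OF f(2) x])
    show "f t < 0" if "a \<le> s" "s < t" "t \<le> b" "f s < 0" for s t
      using concave_on_neg_between[OF f(1), of a t s] a that by (cases "s = a") auto
  qed
  show ?thesis
  proof (cases "\<forall>t\<in>{a..b}. f t \<le> 0")
    case True
    then have neg: "f t < 0" if "t \<in> {a..b}" for t using max that by (auto simp: less_le)
    \<comment> \<open>The whole interval counts, and \<open>x < b - a\<close> is what makes
      \<open>L\<close> true here.\<close>
    have "neg_time f {a..b} = b - a"
      using neg x by (intro neg_time_eq_length) auto
    then have L by (simp add: L_def ennreal_less_iff x)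
    moreover have "\<not> (\<exists>t\<in>{a..b}. f t > 0)" using True by force
    ultimately show ?thesis using True neg[OF ab(1)] neg[OF ab(2)] by (simp add: not_le)
  next
    case False
    then have pos: "\<exists>t\<in>{a..b}. f t > 0" by (auto simp: not_le)
    consider "f a < 0" "f b < 0" | "f a < 0" "0 \<le> f b" | "0 \<le> f a" "f b < 0" | "0 \<le> f a" "0 \<le> f b"
      by linarith
    then show ?thesis
    proof cases
      case 4
      \<comment> \<open>With both ends nonnegative there is no negative point, so every event
        fails.\<close>
      have "0 \<le> f t" if "t \<in> {a..b}" for t
        using concave_on_neg_between[OF f(1) ab, of t] that 4 by (cases "t = a"; cases "t = b") force+
      then have "0 \<le> f (a + x)" "0 \<le> f (b - x)" using x by auto
      with initial[OF 4(2)] show ?thesis using False 4 by simp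
    qed (use False pos initial final in simp_all)
  qed
qed

text \<open>The tangent bound rises towards \<open>a\<close> from the left and falls after
  \<open>b\<close>, so nothing outside \<open>{a..b}\<close> exceeds the end values and a maximiser
  on the compact interval is global.\<close>

lemma max_val_UNIV:
  fixes f :: "real \<Rightarrow> real"
  assumes f: "continuous_on {a..b} f" "a \<le> b"
    and ta: "\<And>t. f t \<le> f a + D * (t - a)" "0 < D" and tb: "\<And>t. f t \<le> f b + D' * (t - b)" "D' < 0"
  shows "\<exists>m\<in>{a..b}. (\<forall>t. f t \<le> f m) \<and> max_val f UNIV = f m"
proof -
  obtain m where m: "m \<in> {a..b}" "\<And>t. t \<in> {a..b} \<Longrightarrow> f t \<le> f m"
    using continuous_attains_sup[of "{a..b}" f] f by auto
  have "f t \<le> f m" for t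
  proof -
    consider "t < a" | "t \<in> {a..b}" | "b < t" by fastforce
    then show ?thesis
    proof cases
      case 1
      then have "D * (t - a) \<le> 0" using ta(2) by (simp add: mult_nonneg_nonpos)
      with ta(1)[of t] m(2)[of a] f show ?thesis by simp
    next
      case 3
      then have "D' * (t - b) \<le> 0" using tb(2) by (simp add: mult_nonpos_nonneg)
      with tb(1)[of t] m(2)[of b] f show ?thesis by simp
    qed (use m in auto)
  qed
  then show ?thesis using m(1) max_val_eq[of m UNIV f] by blast
qed

lemma zeros_UNIV_gap_iff:
  fixes f :: "real \<Rightarrow> real"
  assumes f: "concave_on UNIV f" "continuous_on UNIV f" "a \<le> b"
    and ta: "\<And>t. f t \<le> f a + D * (t - a)" "0 < D" and tb: "\<And>t. f t \<le> f b + D' * (t - b)" "D' < 0"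
    and pos: "\<exists>t\<in>{a..b}. 0 < f t" and x: "0 \<le> x"
  shows "max (zero1 f UNIV - a) 0 + max (b - zero2 f UNIV) 0 > x \<longleftrightarrow> ennreal x < neg_time f {a..b}"
proof -
  obtain m where m: "m \<in> {a..b}" "0 < f m" using pos by auto
  \<comment> \<open>Moving from \<open>a\<close> to \<open>p\<close>, the tangent bound drops by
    \<open>\<bar>f a\<bar> + 1\<close>, hence \<open>f p\<close> is negative; \<open>q\<close> does
    the same at \<open>b\<close>. These are the negative witnesses for the two roots on the
    line.\<close>
  define p where "p = a - (\<bar>f a\<bar> + 1) / D"
  define q where "q = b - (\<bar>f b\<bar> + 1) / D'"
  have p: "D * (p - a) = - (\<bar>f a\<bar> + 1)" and q: "D' * (q - b) = - (\<bar>f b\<bar> + 1)"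
    using ta(2) tb(2) by (simp_all add: p_def q_def)
  have "p < a" "b < q"
    using ta(2) tb(2) by (simp_all add: p_def q_def divide_pos_pos divide_pos_neg add_nonneg_pos)
  then have p: "f p < 0" "p < m" and q: "f q < 0" "m < q"
    using ta(1)[of p] tb(1)[of q] p q m by auto
  note z = concave_on_zeros[OF f(1,2) UNIV_I UNIV_I UNIV_I p(2) q(2) p(1) m(2) q(1)]
  have "neg_time f {a..b} = ennreal (max (zero1 f UNIV - a) 0 + max (b - zero2 f UNIV) 0)"
    using z m by (intro neg_time_two_gaps) auto
  then show ?thesis using x by (auto simp: ennreal_less_iff simp del: ennreal_plus)
qed

text \<open>\<open>D\<close> and \<open>D'\<close> stand for the right slope at \<open>a\<close> and
  the left slope at \<open>b\<close>; their signs select the shape of the negative set. The slope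
  condition in the first event keeps it disjoint from the middle ones, which may also hold when
  \<open>f\<close> is negative throughout. Excluding \<open>D' = 0\<close> rules out
  \<open>D = D' = 0\<close>, where both middle events can occur together.\<close>

lemma occupation_split_UNIV:
  fixes f :: "real \<Rightarrow> real"
  assumes f: "concave_on UNIV f" "continuous_on UNIV f"
    and x: "0 \<le> x" "x < b - a"
    and ta: "\<And>t. f t \<le> f a + D * (t - a)" and tb: "\<And>t. f t \<le> f b + D' * (t - b)"
    and D': "D' \<noteq> 0"
    and max: "\<not> ((\<forall>t\<in>{a..b}. f t \<le> 0) \<and> (\<exists>t\<in>{a..b}. f t = 0))"
  defines "L \<equiv> ennreal x < neg_time f {a..b}"
  shows "(of_bool L :: ennreal) = of_bool ((\<forall>t\<in>{a..b}. f t \<le> 0) \<and> D' < 0 \<and> 0 < D)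
    + (of_bool (f (a + x) < 0 \<and> 0 \<le> D') + of_bool (f (b - x) < 0 \<and> D \<le> 0))
    + of_bool (L \<and> D' < 0 \<and> 0 < D \<and> (\<exists>t\<in>{a..b}. f t > 0))"
proof -
  have cont: "continuous_on {a..b} f" using f(2) continuous_on_subset by blast
  \<comment> \<open>Sum of the two tangent bounds, each evaluated at the opposite end.\<close>
  have "0 \<le> (D - D') * (b - a)"
    using ta[of b] tb[of a] by (simp add: algebra_simps)
  then have DD: "D' \<le> D" using x by (simp add: zero_le_mult_iff)
  have initial: "L \<longleftrightarrow> f (a + x) < 0" if D: "0 \<le> D'"
    unfolding L_def
  proof (rule neg_time_gt_initial[OF cont x])
    show "f t < 0" if st: "a \<le> t" "t < s" "s \<le> b" "f s < 0" for s t
    proof (rule ccontr)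
      assume "\<not> f t < 0"
      \<comment> \<open>With \<open>0 \<le> D'\<close> the tangent bound at \<open>b\<close> makes
        \<open>f b\<close> dominate everything to its left, so a nonnegative \<open>f t\<close>
        would place the negative \<open>f s\<close> between nonnegative values.\<close>
      moreover have "f t \<le> f b"
        using tb[of t] mult_nonneg_nonpos[of D' "t - b"] D st by simp
      ultimately show False
        using concave_on_neg_between[OF f(1), of t b s] st by (cases "s = b") auto
    qed
  qed
  have final: "L \<longleftrightarrow> f (b - x) < 0" if D: "D \<le> 0"
    unfolding L_def
  proof (rule neg_time_gt_final[OF cont x])
    show "f t < 0" if st: "a \<le> s" "s < t" "t \<le> b" "f s < 0" for s t
    proof (rule ccontr)
      assume "\<not> f t < 0"
      moreover have "f t \<le> f a"
        using ta[of t] mult_nonpos_nonneg[of D "t - a"] D st by simp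
      ultimately show False
        using concave_on_neg_between[OF f(1), of a t s] st by (cases "s = a") auto
    qed
  qed
  consider "0 < D'" "0 < D" | "D \<le> 0" "D' < 0" | "D' < 0" "0 < D"
    using D' DD by linarith
  then show ?thesis
  proof cases
    case 1
    with initial show ?thesis by simp
  next
    case 2
    with final show ?thesis by simp
  next
    case 3
    show ?thesis
    proof (cases "\<forall>t\<in>{a..b}. f t \<le> 0")
      case True
      have "neg_time f {a..b} = b - a"
        using True max x by (intro neg_time_eq_length) (auto simp: less_le)
      then have L by (simp add: L_def ennreal_less_iff x)
      moreover have "\<not> (\<exists>t\<in>{a..b}. f t > 0)" using True by force
      ultimately show ?thesis using True 3 by simp
    next
      case False
      then have "\<exists>t\<in>{a..b}. f t > 0" by (auto simp: not_le)
      with False 3 show ?thesis by simp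
    qed
  qed
qed

section \<open>Integration over the noise and the level\<close>

lemma (in prob_space) nn_integral_exp_swap:
  fixes N :: "'a \<Rightarrow> real" and W :: "real \<times> real \<Rightarrow> ennreal"
  assumes N[measurable]: "N \<in> borel_measurable M" and W[measurable]: "W \<in> borel_measurable borel"
  shows "(\<integral>\<^sup>+z. (\<integral>\<^sup>+\<omega>. ennreal (exp z) * W (N \<omega>, z) \<partial>M) \<partial>lborel)
    = (\<integral>\<^sup>+\<omega>. (\<integral>\<^sup>+z. ennreal (exp z) * W (N \<omega>, z) \<partial>lborel) \<partial>M)"
proof -
  interpret pair_sigma_finite M "lborel :: real measure" ..
  have [measurable]: "W \<in> borel_measurable (borel \<Otimes>\<^sub>M borel)" using W by (simp add: borel_prod)
  show ?thesis by (rule Fubini') measurable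
qed

lemma (in prob_space) exp_prob_eq_nn_integral:
  fixes N :: "'a \<Rightarrow> real" and Q :: "real \<times> real \<Rightarrow> bool"
  assumes N[measurable]: "N \<in> borel_measurable M" and Q[measurable]: "Measurable.pred borel Q"
  shows "ennreal (exp z * \<P>(\<omega> in M. Q (N \<omega>, z))) = (\<integral>\<^sup>+\<omega>. ennreal (exp z) * of_bool (Q (N \<omega>, z)) \<partial>M)"
proof -
  have [measurable]: "Measurable.pred (borel \<Otimes>\<^sub>M borel) Q" using Q by (simp add: borel_prod)
  have "(\<integral>\<^sup>+\<omega>. ennreal (exp z) * of_bool (Q (N \<omega>, z)) \<partial>M)
      = (\<integral>\<^sup>+\<omega>. ennreal (exp z) * indicator {\<omega> \<in> space M. Q (N \<omega>, z)} \<omega> \<partial>M)"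
    by (intro nn_integral_cong) (auto simp: indicator_def)
  also have "\<dots> = ennreal (exp z) * emeasure M {\<omega> \<in> space M. Q (N \<omega>, z)}"
    by (intro nn_integral_cmult_indicator) measurable
  finally show ?thesis by (simp add: emeasure_eq_measure ennreal_mult')
qed

text \<open>Transfers the pathwise decomposition to the integrals. After the interchange the level
  is the inner variable, so the exceptional null set of levels may depend on the noise.
  \<open>B\<close> and \<open>C\<close> share one integral to match the shape of the
  formulas.\<close>

lemma (in prob_space) exp_prob_split:
  fixes N :: "'a \<Rightarrow> real" and L A B C D :: "real \<times> real \<Rightarrow> bool"
  assumes N[measurable]: "N \<in> borel_measurable M"
    and Q: "Measurable.pred borel L" "Measurable.pred borel A" "Measurable.pred borel B"
      "Measurable.pred borel C" "Measurable.pred borel D"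
    and split: "AE \<omega> in M. AE z in lborel. (of_bool (L (N \<omega>, z)) :: ennreal) = of_bool (A (N \<omega>, z))
      + (of_bool (B (N \<omega>, z)) + of_bool (C (N \<omega>, z))) + of_bool (D (N \<omega>, z))"
  shows "(\<integral>\<^sup>+z. ennreal (exp z * \<P>(\<omega> in M. L (N \<omega>, z))) \<partial>lborel)
    = (\<integral>\<^sup>+z. ennreal (exp z * \<P>(\<omega> in M. A (N \<omega>, z))) \<partial>lborel)
    + (\<integral>\<^sup>+z. ennreal (exp z * (\<P>(\<omega> in M. B (N \<omega>, z)) + \<P>(\<omega> in M. C (N \<omega>, z)))) \<partial>lborel)
    + (\<integral>\<^sup>+z. ennreal (exp z * \<P>(\<omega> in M. D (N \<omega>, z))) \<partial>lborel)"
proof -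
  define J where "J W = (\<integral>\<^sup>+\<omega>. (\<integral>\<^sup>+z. ennreal (exp z) * W (N \<omega>, z) \<partial>lborel) \<partial>M)" for W
  have meas: "(\<lambda>p. of_bool (Q p) :: ennreal) \<in> borel_measurable borel"
    if "Measurable.pred borel Q" for Q :: "real \<times> real \<Rightarrow> bool"
    using that by (rule measurable_compose) simp
  have slice: "(\<lambda>\<omega>. ennreal (exp z) * of_bool (Q (N \<omega>, z))) \<in> borel_measurable M"
    if "Measurable.pred borel Q" for Q z
  proof -
    note [measurable] = meas[OF that, folded borel_prod]
    show ?thesis by measurable
  qed
  have J_add: "J (\<lambda>p. V p + W p) = J V + J W"
    if "V \<in> borel_measurable borel" "W \<in> borel_measurable borel" for V W :: "real \<times> real \<Rightarrow> ennreal"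
  proof -
    note [measurable] = that[folded borel_prod]
    show ?thesis
      unfolding J_def distrib_left
      by (subst nn_integral_add[symmetric], measurable, intro nn_integral_cong nn_integral_add) measurable
  qed
  have J_prob: "(\<integral>\<^sup>+z. ennreal (exp z * \<P>(\<omega> in M. Q (N \<omega>, z))) \<partial>lborel) = J (\<lambda>p. of_bool (Q p))"
    if "Measurable.pred borel Q" for Q
    unfolding J_def nn_integral_exp_swap[OF N meas[OF that], symmetric]
    by (simp only: exp_prob_eq_nn_integral[OF N that])
  have "(\<integral>\<^sup>+z. ennreal (exp z * (\<P>(\<omega> in M. B (N \<omega>, z)) + \<P>(\<omega> in M. C (N \<omega>, z)))) \<partial>lborel)
      = (\<integral>\<^sup>+z. (\<integral>\<^sup>+\<omega>. ennreal (exp z) * (of_bool (B (N \<omega>, z)) + of_bool (C (N \<omega>, z))) \<partial>M) \<partial>lborel)"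
    by (intro nn_integral_cong)
      (simp add: distrib_left nn_integral_add[OF slice[OF Q(3)] slice[OF Q(4)]]
        exp_prob_eq_nn_integral[OF N Q(3)] exp_prob_eq_nn_integral[OF N Q(4)])
  also have "\<dots> = J (\<lambda>p. of_bool (B p) + of_bool (C p))"
    unfolding J_def by (intro nn_integral_exp_swap[OF N] borel_measurable_add meas Q)
  finally have mid: "(\<integral>\<^sup>+z. ennreal (exp z * (\<P>(\<omega> in M. B (N \<omega>, z)) + \<P>(\<omega> in M. C (N \<omega>, z)))) \<partial>lborel)
      = J (\<lambda>p. of_bool (B p) + of_bool (C p))" .
  have "J (\<lambda>p. of_bool (L p)) = J (\<lambda>p. of_bool (A p) + (of_bool (B p) + of_bool (C p)) + of_bool (D p))"
    unfolding J_def using split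
    by (intro nn_integral_cong_AE, eventually_elim) (intro nn_integral_cong_AE, auto)
  also have "\<dots> = J (\<lambda>p. of_bool (A p)) + J (\<lambda>p. of_bool (B p) + of_bool (C p)) + J (\<lambda>p. of_bool (D p))"
    using Q[THEN meas] by (simp add: J_add)
  finally show ?thesis
    unfolding mid J_prob[OF Q(1)] J_prob[OF Q(2)] J_prob[OF Q(5)] .
qed

section \<open>The function \<open>f\<^sub>N\<close>\<close>

lemma concave_on_fN:
  assumes "concave_on E (\<lambda>t. h t + t\<^sup>2)"
  shows "concave_on E (fN h n z)"
proof -
  have "concave_on E (\<lambda>t. z - sqrt 2 * n * t)"
    using concave_on_imp_convex[OF assms]
    by (auto simp: concave_on_iff algebra_simps simp flip: distrib_right)
  from concave_on_add[OF assms this] show ?thesis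
    by (simp add: fN_def[abs_def] algebra_simps)
qed

lemma continuous_on_fN:
  assumes "continuous_on E (\<lambda>t. h t + t\<^sup>2)"
  shows "continuous_on E (fN h n z)"
  unfolding fN_def[abs_def] by (intro continuous_intros assms)

lemma occupation_eq_neg_time:
  assumes "continuous_on {a..b} (\<lambda>t. h t + t\<^sup>2)"
  shows "(\<integral>\<^sup>+t\<in>{a..b}. indicator {t. sqrt 2 * n * t - t\<^sup>2 - h t - z > 0} t \<partial>lborel)
    = neg_time (fN h n z) {a..b}"
proof -
  have "(\<integral>\<^sup>+t\<in>{a..b}. indicator {t. sqrt 2 * n * t - t\<^sup>2 - h t - z > 0} t \<partial>lborel)
      = (\<integral>\<^sup>+t. indicator {t \<in> {a..b}. fN h n z t < 0} t \<partial>lborel)"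
    by (intro nn_integral_cong) (auto simp: fN_def indicator_def)
  also have "\<dots> = neg_time (fN h n z) {a..b}"
    using sets_neg_set[OF continuous_on_fN[OF assms]] by (simp add: neg_time_def)
  finally show ?thesis .
qed

text \<open>Changing \<open>z\<close> shifts the whole path by a constant, so two levels with
  maximum 0 attained on \<open>E\<close> must coincide.\<close>

lemma AE_fN_max_nonzero:
  "AE z in lborel. \<not> ((\<forall>t\<in>E. fN h n z t \<le> 0) \<and> (\<exists>t\<in>E. fN h n z t = 0))"
proof -
  let ?B = "{z. (\<forall>t\<in>E. fN h n z t \<le> 0) \<and> (\<exists>t\<in>E. fN h n z t = 0)}"
  have le: "z' \<le> z" if "z \<in> ?B" "z' \<in> ?B" for z z'
  proof -
    from that(1) obtain t where t: "t \<in> E" "fN h n z t = 0" by auto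
    with that(2) have "fN h n z' t \<le> 0" by auto
    with t show ?thesis by (simp add: fN_def)
  qed
  have "\<exists>z0. ?B \<subseteq> {z0}"
  proof (cases "?B = {}")
    case False
    then obtain z0 where z0: "z0 \<in> ?B" by blast
    have "z = z0" if "z \<in> ?B" for z
      using le[OF that z0] le[OF z0 that] by (rule order_antisym[rotated])
    then show ?thesis by blast
  qed blast
  then obtain z0 where "?B \<subseteq> {z0}" ..
  with AE_lborel_singleton[of z0] show ?thesis
    by (auto elim!: eventually_mono)
qed

lemma borel_fN_at [measurable]:
  "(\<lambda>p. fN h (fst p) (snd p) t) \<in> borel_measurable (borel :: (real \<times> real) measure)"
  unfolding fN_def by (intro borel_measurable_continuous_onI continuous_intros)

text \<open>For fixed \<open>t\<close> the condition defines a closed half-plane in noise and level,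
  and an arbitrary intersection of closed sets is closed. Hence \<open>E\<close> may be uncountable
  and \<open>h\<close> arbitrary.\<close>

lemma borel_fN_le_0 [measurable]:
  "Measurable.pred (borel :: (real \<times> real) measure) (\<lambda>p. \<forall>t\<in>E. fN h (fst p) (snd p) t \<le> 0)"
proof -
  have "closed (\<Inter>t\<in>E. {p. fN h (fst p) (snd p) t \<le> 0})"
    unfolding fN_def by (intro closed_INT ballI closed_Collect_le continuous_intros)
  also have "(\<Inter>t\<in>E. {p. fN h (fst p) (snd p) t \<le> 0}) = {p. \<forall>t\<in>E. fN h (fst p) (snd p) t \<le> 0}"
    by auto
  finally show ?thesis by (simp add: pred_def borel_closed)
qed

lemma borel_fN_pos [measurable]:
  "Measurable.pred (borel :: (real \<times> real) measure) (\<lambda>p. \<exists>t\<in>E. fN h (fst p) (snd p) t > 0)"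
proof -
  have "Measurable.pred borel (\<lambda>p. \<not> (\<forall>t\<in>E. fN h (fst p) (snd p) t \<le> 0))"
    by measurable
  then show ?thesis by (simp add: not_le)
qed

text \<open>\<open>neg_time\<close> is the measure of the time section of a measurable set
  \<open>X\<close> in noise, level and time.\<close>

lemma borel_neg_time_fN:
  assumes "continuous_on {a..b} (\<lambda>t. h t + t\<^sup>2)"
  shows "(\<lambda>p. neg_time (fN h (fst p) (snd p)) {a..b})
    \<in> borel_measurable (borel :: (real \<times> real) measure)"
proof -
  \<comment> \<open>The cut-off is needed because \<open>h\<close> is only controlled on
    \<open>{a..b}\<close>; \<open>X\<close> looks at \<open>k\<close> on that interval only.\<close>
  define k where "k = (\<lambda>t. indicator {a..b} t *\<^sub>R (h t + t\<^sup>2))"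
  have [measurable]: "k \<in> borel_measurable borel"
    unfolding k_def using assms by (intro borel_measurable_continuous_on_indicator) auto
  define X where "X = {q \<in> space ((borel \<Otimes>\<^sub>M borel) \<Otimes>\<^sub>M lborel).
    a \<le> snd q \<and> snd q \<le> b \<and> k (snd q) - sqrt 2 * fst (fst q) * snd q + snd (fst q) < 0}"
  have "X \<in> sets ((borel \<Otimes>\<^sub>M borel) \<Otimes>\<^sub>M lborel)"
    unfolding X_def by measurable
  then have "(\<lambda>p. emeasure lborel (Pair p -` X)) \<in> borel_measurable (borel \<Otimes>\<^sub>M borel)"
    by (rule lborel.measurable_emeasure_Pair)
  also have "(\<lambda>p. emeasure lborel (Pair p -` X)) = (\<lambda>p. neg_time (fN h (fst p) (snd p)) {a..b})"
  proof
    fix p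
    have "Pair p -` X = {t \<in> {a..b}. fN h (fst p) (snd p) t < 0}"
      by (auto simp: X_def k_def fN_def space_pair_measure)
    then show "emeasure lborel (Pair p -` X) = neg_time (fN h (fst p) (snd p)) {a..b}"
      by (simp only: neg_time_def)
  qed
  finally show ?thesis by (simp only: borel_prod)
qed

section \<open>The two formulas for standard normal noise\<close>

context
  fixes M :: "'w measure" and N :: "'w \<Rightarrow> real" and h :: "real \<Rightarrow> real" and a b x :: real
  assumes M: "prob_space M" and N: "distributed M lborel N std_normal_density"
    and ab: "a < b" and x: "0 \<le> x" "x < b - a"
begin

interpretation prob_space M by (rule M)

lemma N_borel: "N \<in> borel_measurable M"
  using distributed_measurable[OF N] by simp

lemma AE_N_neq: "AE \<omega> in M. N \<omega> \<noteq> c"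
proof -
  have "AE n in lborel. 0 < ennreal (std_normal_density n) \<longrightarrow> n \<noteq> c"
    using AE_lborel_singleton[of c] by (auto elim!: eventually_mono)
  then show ?thesis using distributed_AE2[OF N, of "\<lambda>n. n \<noteq> c"] by simp
qed

text \<open>The events involving \<open>max_val\<close>, \<open>zero1\<close> and
  \<open>zero2\<close> are first rewritten through signs and \<open>neg_time\<close>, whose
  measurability is established; then the decomposition is integrated.\<close>

lemma PB_Icc:
  assumes cont: "continuous_on {a..b} (\<lambda>t. h t + t\<^sup>2)" and conc: "concave_on {a..b} (\<lambda>t. h t + t\<^sup>2)"
  shows "PB M N h {a..b} x =
          (\<integral>\<^sup>+z. ennreal (exp z * \<P>(\<omega> in M. max_val (fN h (N \<omega>) z) {a..b} \<le> 0)) \<partial>lborel)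
        + (\<integral>\<^sup>+z. ennreal (exp z *
             (\<P>(\<omega> in M. fN h (N \<omega>) z (a + x) < 0 \<and> fN h (N \<omega>) z b \<ge> 0)
            + \<P>(\<omega> in M. fN h (N \<omega>) z a \<ge> 0 \<and> fN h (N \<omega>) z (b - x) < 0))) \<partial>lborel)
        + (\<integral>\<^sup>+z. ennreal (exp z *
             \<P>(\<omega> in M. b - a - (zero2 (fN h (N \<omega>) z) {a..b} - zero1 (fN h (N \<omega>) z) {a..b}) > x
                \<and> max_val (fN h (N \<omega>) z) {a..b} > 0
                \<and> fN h (N \<omega>) z a < 0 \<and> fN h (N \<omega>) z b < 0)) \<partial>lborel)"
proof -
  note [measurable] = borel_neg_time_fN[OF cont]
  note f = concave_on_fN[OF conc] continuous_on_fN[OF cont]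
  have max_le: "max_val (fN h n z) {a..b} \<le> 0 \<longleftrightarrow> (\<forall>t\<in>{a..b}. fN h n z t \<le> 0)" for n z
    using f ab by (intro max_val_Icc_le_0_iff) auto
  have max_gt: "0 < max_val (fN h n z) {a..b} \<longleftrightarrow> (\<exists>t\<in>{a..b}. 0 < fN h n z t)" for n z
    using max_le[of n z] by (auto simp: not_le)
  have gap: "(b - a - (zero2 (fN h n z) {a..b} - zero1 (fN h n z) {a..b}) > x
        \<and> max_val (fN h n z) {a..b} > 0 \<and> fN h n z a < 0 \<and> fN h n z b < 0)
      \<longleftrightarrow> (ennreal x < neg_time (fN h n z) {a..b}
        \<and> (\<exists>t\<in>{a..b}. fN h n z t > 0) \<and> fN h n z a < 0 \<and> fN h n z b < 0)" for n z
    using zeros_gap_iff[OF f _ _ _ x(1), of n z] max_gt[of n z] by blast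
  show ?thesis
    unfolding PB_def occupation_eq_neg_time[OF cont] max_le gap
    using exp_prob_split[OF N_borel,
      of "\<lambda>p. ennreal x < neg_time (fN h (fst p) (snd p)) {a..b}"
        "\<lambda>p. \<forall>t\<in>{a..b}. fN h (fst p) (snd p) t \<le> 0"
        "\<lambda>p. fN h (fst p) (snd p) (a + x) < 0 \<and> fN h (fst p) (snd p) b \<ge> 0"
        "\<lambda>p. fN h (fst p) (snd p) a \<ge> 0 \<and> fN h (fst p) (snd p) (b - x) < 0"
        "\<lambda>p. ennreal x < neg_time (fN h (fst p) (snd p)) {a..b}
          \<and> (\<exists>t\<in>{a..b}. fN h (fst p) (snd p) t > 0)
          \<and> fN h (fst p) (snd p) a < 0 \<and> fN h (fst p) (snd p) b < 0",
      unfolded fst_conv snd_conv]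
  proof this
    show "AE \<omega> in M. AE z in lborel. (of_bool (ennreal x < neg_time (fN h (N \<omega>) z) {a..b}) :: ennreal)
      = of_bool (\<forall>t\<in>{a..b}. fN h (N \<omega>) z t \<le> 0)
      + (of_bool (fN h (N \<omega>) z (a + x) < 0 \<and> fN h (N \<omega>) z b \<ge> 0)
        + of_bool (fN h (N \<omega>) z a \<ge> 0 \<and> fN h (N \<omega>) z (b - x) < 0))
      + of_bool (ennreal x < neg_time (fN h (N \<omega>) z) {a..b} \<and> (\<exists>t\<in>{a..b}. fN h (N \<omega>) z t > 0)
        \<and> fN h (N \<omega>) z a < 0 \<and> fN h (N \<omega>) z b < 0)"
      by (intro AE_I2 AE_fN_max_nonzero[THEN eventually_mono] occupation_split_Icc[OF f x])
  qed measurable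
qed

lemma PB_UNIV:
  assumes cont: "continuous_on UNIV (\<lambda>t. h t + t\<^sup>2)" and conc: "concave_on UNIV (\<lambda>t. h t + t\<^sup>2)"
    and da: "(h has_real_derivative hra) (at_right a)" and db: "(h has_real_derivative hlb) (at_left b)"
  shows "PB M N h {a..b} x =
          (\<integral>\<^sup>+z\<in>{..- h 0}. ennreal (exp z *
             \<P>(\<omega> in M. max_val (fN h (N \<omega>) z) UNIV \<le> 0
                \<and> hlb + 2 * b < sqrt 2 * N \<omega> \<and> sqrt 2 * N \<omega> < hra + 2 * a)) \<partial>lborel)
        + (\<integral>\<^sup>+z. ennreal (exp z *
             (\<P>(\<omega> in M. fN h (N \<omega>) z (a + x) < 0 \<and> sqrt 2 * N \<omega> \<le> hlb + 2 * b)
            + \<P>(\<omega> in M. fN h (N \<omega>) z (b - x) < 0 \<and> sqrt 2 * N \<omega> \<ge> hra + 2 * a))) \<partial>lborel)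
        + (\<integral>\<^sup>+z. ennreal (exp z *
             \<P>(\<omega> in M. max (zero1 (fN h (N \<omega>) z) UNIV - a) 0 + max (b - zero2 (fN h (N \<omega>) z) UNIV) 0 > x
                \<and> hlb + 2 * b < sqrt 2 * N \<omega> \<and> sqrt 2 * N \<omega> < hra + 2 * a
                \<and> max_val (fN h (N \<omega>) z) UNIV > 0)) \<partial>lborel)"
proof -
  have cont': "continuous_on {a..b} (\<lambda>t. h t + t\<^sup>2)" using cont continuous_on_subset by blast
  note [measurable] = borel_neg_time_fN[OF cont']
  note f = concave_on_fN[OF conc] continuous_on_fN[OF cont]
  \<comment> \<open>\<open>D n\<close> and \<open>D' n\<close> are the right derivative at
    \<open>a\<close> and the left derivative at \<open>b\<close> of the path with noise value
    \<open>n\<close>; the level does not enter.\<close>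
  define D where "D n = hra + 2 * a - sqrt 2 * n" for n
  define D' where "D' n = hlb + 2 * b - sqrt 2 * n" for n
  have ta: "fN h n z t \<le> fN h n z a + D n * (t - a)" for n z t
    using da by (intro concave_on_le_tangent[OF f(1), of _ _ _ _ "{a<..}"])
      (auto simp: fN_def[abs_def] D_def intro!: derivative_eq_intros)
  have tb: "fN h n z t \<le> fN h n z b + D' n * (t - b)" for n z t
    using db by (intro concave_on_le_tangent[OF f(1), of _ _ _ _ "{..<b}"])
      (auto simp: fN_def[abs_def] D'_def intro!: derivative_eq_intros)
  have slopes: "hlb + 2 * b < sqrt 2 * n \<longleftrightarrow> D' n < 0" "sqrt 2 * n < hra + 2 * a \<longleftrightarrow> 0 < D n"
      "sqrt 2 * n \<le> hlb + 2 * b \<longleftrightarrow> 0 \<le> D' n" "sqrt 2 * n \<ge> hra + 2 * a \<longleftrightarrow> D n \<le> 0" for n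
    by (auto simp: D_def D'_def)
  have [measurable]: "(\<lambda>p. D (fst p)) \<in> borel_measurable (borel :: (real \<times> real) measure)"
      "(\<lambda>p. D' (fst p)) \<in> borel_measurable (borel :: (real \<times> real) measure)"
    unfolding D_def D'_def by (intro borel_measurable_continuous_onI continuous_intros)+
  have cont_f: "continuous_on {a..b} (fN h n z)" for n z
    using continuous_on_fN[OF cont'] .
  have max_ex: "\<exists>m\<in>{a..b}. (\<forall>t. fN h n z t \<le> fN h n z m) \<and> max_val (fN h n z) UNIV = fN h n z m"
    if "D' n < 0" "0 < D n" for n z
    using that ab by (intro max_val_UNIV[OF cont_f _ ta _ tb]) auto
  have max_le: "(max_val (fN h n z) UNIV \<le> 0 \<and> D' n < 0 \<and> 0 < D n)
      \<longleftrightarrow> ((\<forall>t\<in>{a..b}. fN h n z t \<le> 0) \<and> D' n < 0 \<and> 0 < D n)" for n z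
    using max_ex[of n z] by (metis order_trans)
  have max_gt: "(D' n < 0 \<and> 0 < D n \<and> 0 < max_val (fN h n z) UNIV)
      \<longleftrightarrow> (D' n < 0 \<and> 0 < D n \<and> (\<exists>t\<in>{a..b}. 0 < fN h n z t))" for n z
    using max_le[of n z] by (meson not_le)
  have gap: "(max (zero1 (fN h n z) UNIV - a) 0 + max (b - zero2 (fN h n z) UNIV) 0 > x
        \<and> D' n < 0 \<and> 0 < D n \<and> max_val (fN h n z) UNIV > 0)
      \<longleftrightarrow> (ennreal x < neg_time (fN h n z) {a..b}
        \<and> D' n < 0 \<and> 0 < D n \<and> (\<exists>t\<in>{a..b}. fN h n z t > 0))" for n z
    unfolding max_gt using zeros_UNIV_gap_iff[OF f _ ta _ tb _ _ x(1)] ab by fastforce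
  \<comment> \<open>At time 0 the path has the value \<open>h 0 + z\<close>. A nonpositive global
    maximum therefore forces \<open>z \<le> - h 0\<close>, and for larger levels the event is
    empty.\<close>
  have level: "(\<integral>\<^sup>+z\<in>{..- h 0}. ennreal (exp z *
        \<P>(\<omega> in M. max_val (fN h (N \<omega>) z) UNIV \<le> 0 \<and> D' (N \<omega>) < 0 \<and> 0 < D (N \<omega>))) \<partial>lborel)
      = (\<integral>\<^sup>+z. ennreal (exp z *
        \<P>(\<omega> in M. max_val (fN h (N \<omega>) z) UNIV \<le> 0 \<and> D' (N \<omega>) < 0 \<and> 0 < D (N \<omega>))) \<partial>lborel)"
  proof (intro nn_integral_cong)
    fix z
    have "z \<le> - h 0" if "max_val (fN h n z) UNIV \<le> 0" "D' n < 0" "0 < D n" for n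
    proof -
      from max_ex[OF that(2,3)] obtain m where "fN h n z 0 \<le> fN h n z m" "max_val (fN h n z) UNIV = fN h n z m"
        by blast
      with that(1) have "fN h n z 0 \<le> 0" by simp
      then show ?thesis by (simp add: fN_def)
    qed
    then have "\<not> z \<le> - h 0 \<Longrightarrow>
      {\<omega> \<in> space M. max_val (fN h (N \<omega>) z) UNIV \<le> 0 \<and> D' (N \<omega>) < 0 \<and> 0 < D (N \<omega>)} = {}" by blast
    then show "ennreal (exp z *
        \<P>(\<omega> in M. max_val (fN h (N \<omega>) z) UNIV \<le> 0 \<and> D' (N \<omega>) < 0 \<and> 0 < D (N \<omega>))) * indicator {..- h 0} z
      = ennreal (exp z *
        \<P>(\<omega> in M. max_val (fN h (N \<omega>) z) UNIV \<le> 0 \<and> D' (N \<omega>) < 0 \<and> 0 < D (N \<omega>)))"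
      by (cases "z \<le> - h 0") (simp_all del: Collect_empty_eq)
  qed
  show ?thesis
    unfolding PB_def occupation_eq_neg_time[OF cont'] slopes level
    unfolding gap max_le
    using exp_prob_split[OF N_borel,
      of "\<lambda>p. ennreal x < neg_time (fN h (fst p) (snd p)) {a..b}"
        "\<lambda>p. (\<forall>t\<in>{a..b}. fN h (fst p) (snd p) t \<le> 0) \<and> D' (fst p) < 0 \<and> 0 < D (fst p)"
        "\<lambda>p. fN h (fst p) (snd p) (a + x) < 0 \<and> 0 \<le> D' (fst p)"
        "\<lambda>p. fN h (fst p) (snd p) (b - x) < 0 \<and> D (fst p) \<le> 0"
        "\<lambda>p. ennreal x < neg_time (fN h (fst p) (snd p)) {a..b} \<and> D' (fst p) < 0 \<and> 0 < D (fst p)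
          \<and> (\<exists>t\<in>{a..b}. fN h (fst p) (snd p) t > 0)",
      unfolded fst_conv snd_conv]
  proof this
    \<comment> \<open>\<open>D'\<close> vanishes at a single noise value, which has probability 0
      under the normal density.\<close>
    have neq: "AE \<omega> in M. D' (N \<omega>) \<noteq> 0"
      using AE_N_neq[of "(hlb + 2 * b) / sqrt 2"] by eventually_elim (simp add: D'_def field_simps)
    show "AE \<omega> in M. AE z in lborel. (of_bool (ennreal x < neg_time (fN h (N \<omega>) z) {a..b}) :: ennreal)
      = of_bool ((\<forall>t\<in>{a..b}. fN h (N \<omega>) z t \<le> 0) \<and> D' (N \<omega>) < 0 \<and> 0 < D (N \<omega>))
      + (of_bool (fN h (N \<omega>) z (a + x) < 0 \<and> 0 \<le> D' (N \<omega>))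
        + of_bool (fN h (N \<omega>) z (b - x) < 0 \<and> D (N \<omega>) \<le> 0))
      + of_bool (ennreal x < neg_time (fN h (N \<omega>) z) {a..b} \<and> D' (N \<omega>) < 0 \<and> 0 < D (N \<omega>)
        \<and> (\<exists>t\<in>{a..b}. fN h (N \<omega>) z t > 0))"
      using neq
      by eventually_elim
        (intro AE_fN_max_nonzero[THEN eventually_mono] occupation_split_UNIV[OF f x ta tb])
  qed measurable
qed

end

text \<open>The outer derivatives exist for the concave function \<open>h t + t\<^sup>2\<close>, and
  subtracting the square transfers them to \<open>h\<close>. Evaluating each tangent bound at the
  other point gives \<open>R \<le> L\<close>; passing to \<open>h\<close> subtracts
  \<open>2 * b\<close> and \<open>2 * a\<close>, which preserves the order because
  \<open>a < b\<close>.\<close>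

lemma concave_one_sided_derivatives:
  fixes h :: "real \<Rightarrow> real"
  assumes conc: "concave_on UNIV (\<lambda>t. h t + t\<^sup>2)" and ab: "a < b"
  shows "\<exists>hrb hla. (h has_real_derivative hrb) (at_right b)
    \<and> (h has_real_derivative hla) (at_left a) \<and> hrb \<le> hla"
proof -
  obtain R where R: "((\<lambda>t. h t + t\<^sup>2) has_real_derivative R) (at_right b)"
    using concave_on_has_right_derivative[OF conc] by blast
  obtain L where L: "((\<lambda>t. h t + t\<^sup>2) has_real_derivative L) (at_left a)"
    using concave_on_has_left_derivative[OF conc] by blast
  have "((\<lambda>t. (h t + t\<^sup>2) - t\<^sup>2) has_real_derivative R - 2 * b) (at_right b)"
    by (rule derivative_eq_intros R refl | simp)+
  moreover have "((\<lambda>t. (h t + t\<^sup>2) - t\<^sup>2) has_real_derivative L - 2 * a) (at_left a)"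
    by (rule derivative_eq_intros L refl | simp)+
  moreover have "0 \<le> (L - R) * (b - a)"
    using concave_on_le_tangent[OF conc R, of a] concave_on_le_tangent[OF conc L, of b]
    by (simp add: algebra_simps)
  then have "R \<le> L" using ab by (simp add: zero_le_mult_iff)
  ultimately show ?thesis using ab by (intro exI[of _ "R - 2 * b"] exI[of _ "L - 2 * a"]) simp
qed

theorem theorem5p1:
  fixes M :: "'w measure" and N :: "'w \<Rightarrow> real"
    and h :: "real \<Rightarrow> real" and a b x :: real
  assumes "prob_space M"
    and "distributed M lborel N std_normal_density"
    and "a < b" and "0 \<le> x" and "x < b - a"
  shows
    "(continuous_on {a..b} (\<lambda>t. h t + t\<^sup>2) \<and> concave_on {a..b} (\<lambda>t. h t + t\<^sup>2) \<longrightarrow>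
        PB M N h {a..b} x =
          (\<integral>\<^sup>+z. ennreal (exp z * \<P>(\<omega> in M. max_val (fN h (N \<omega>) z) {a..b} \<le> 0)) \<partial>lborel)
        + (\<integral>\<^sup>+z. ennreal (exp z *
             (\<P>(\<omega> in M. fN h (N \<omega>) z (a + x) < 0 \<and> fN h (N \<omega>) z b \<ge> 0)
            + \<P>(\<omega> in M. fN h (N \<omega>) z a \<ge> 0 \<and> fN h (N \<omega>) z (b - x) < 0))) \<partial>lborel)
        + (\<integral>\<^sup>+z. ennreal (exp z *
             \<P>(\<omega> in M. b - a - (zero2 (fN h (N \<omega>) z) {a..b} - zero1 (fN h (N \<omega>) z) {a..b}) > x
                \<and> max_val (fN h (N \<omega>) z) {a..b} > 0
                \<and> fN h (N \<omega>) z a < 0 \<and> fN h (N \<omega>) z b < 0)) \<partial>lborel))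
   \<and>
     (\<forall>hra hlb.
        continuous_on UNIV (\<lambda>t. h t + t\<^sup>2) \<and> concave_on UNIV (\<lambda>t. h t + t\<^sup>2)
        \<and> (h has_real_derivative hra) (at_right a) \<and> (h has_real_derivative hlb) (at_left b) \<longrightarrow>
        (\<exists>hrb hla. (h has_real_derivative hrb) (at_right b)
           \<and> (h has_real_derivative hla) (at_left a) \<and> hrb \<le> hla)
        \<and> PB M N h {a..b} x =
          (\<integral>\<^sup>+z\<in>{..- h 0}. ennreal (exp z *
             \<P>(\<omega> in M. max_val (fN h (N \<omega>) z) UNIV \<le> 0
                \<and> hlb + 2 * b < sqrt 2 * N \<omega> \<and> sqrt 2 * N \<omega> < hra + 2 * a)) \<partial>lborel)
        + (\<integral>\<^sup>+z. ennreal (exp z *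
             (\<P>(\<omega> in M. fN h (N \<omega>) z (a + x) < 0 \<and> sqrt 2 * N \<omega> \<le> hlb + 2 * b)
            + \<P>(\<omega> in M. fN h (N \<omega>) z (b - x) < 0 \<and> sqrt 2 * N \<omega> \<ge> hra + 2 * a))) \<partial>lborel)
        + (\<integral>\<^sup>+z. ennreal (exp z *
             \<P>(\<omega> in M. max (zero1 (fN h (N \<omega>) z) UNIV - a) 0 + max (b - zero2 (fN h (N \<omega>) z) UNIV) 0 > x
                \<and> hlb + 2 * b < sqrt 2 * N \<omega> \<and> sqrt 2 * N \<omega> < hra + 2 * a
                \<and> max_val (fN h (N \<omega>) z) UNIV > 0)) \<partial>lborel))"
proof (intro conjI allI impI, goal_cases)
  case 1
  then show ?case by (intro PB_Icc[OF assms]) auto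
next
  case 2
  then show ?case using assms(3) by (intro concave_one_sided_derivatives) auto
next
  case 3
  then show ?case by (intro PB_UNIV[OF assms]) auto
qed

end
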